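(* Let $y$ be uniform on $\{1,\dots,K\}$. For each $k$ let $q(z_c,z_s\mid y=k)$ be a joint probability distribution of $(z_c,z_s)$, let $p(z_c\mid y=k)$ be a probability distribution for $z_c$, and let $p(z_s)=\mathcal N(0,I)$. Define $M_{\mathrm{fact}} := \mathbb E_y[\mathrm{KL}(q(z_c,z_s\mid y)\,\|\,p(z_c\mid y)\,p(z_s))]$. Let $\mathrm{Dec}$ be a decoder, i.e. a measurable map $(z_c,z_s)\mapsto \mathrm{Dec}(z_c,z_s)$ into a measurable space, and for a probability measure $\mu$ on pairs $(z_c,z_s)$ let $\mathrm{Dec}_\#\mu$ be the law of $\mathrm{Dec}(z_c,z_s)$ when $(z_c,z_s)\sim\mu$. Then $$\mathbb E_y\bigl[\mathrm{KL}\bigl(\mathrm{Dec}_\# q(\cdot\mid y)\,\|\,\mathrm{Dec}_\#[p(z_c\mid y)\,p(z_s)]\bigr)\bigr]\le M_{\mathrm{fact}}.$$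
   Context: Here $K\ge 1$ is an integer; $z_c$ (the semantic variable) takes values in a measurable space and $z_s$ (the style variable) takes values in $\mathbb R^{d_s}$. $q(\cdot\mid y=k)=q(z_c,z_s\mid y=k)$ is the encoder's joint class-conditional distribution. $p(z_c\mid y)\,p(z_s)$ denotes the product measure (the law of independently drawn $z_c\sim p(z_c\mid y)$ and $z_s\sim p(z_s)$). $\mathbb E_y$ is expectation over the uniform label $y$. $\mathrm{KL}$ is the Kullback–Leibler divergence, with values in $[0,\infty]$. *)

theory Defs
  imports "HOL-Probability.Probability"
begin

text \<open>
  \<open>KL Q P\<close> is the divergence of \<open>Q\<close> from \<open>P\<close>, in nats and with values in \<open>[0, \<infinity>]\<close>.
  The library's \<open>KL_divergence b M N\<close> has the reference measure as its first measure argument,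
  is real-valued, and is meaningful only if \<open>N\<close> has a density w.r.t. \<open>M\<close> and the log-density is
  \<open>N\<close>-integrable. For probability measures \<open>Q \<lless> P\<close> the negative part of the log-density is
  always \<open>Q\<close>-integrable, so failure of integrability means that the divergence is \<open>\<infinity>\<close>;
  and if the integral exists it is nonnegative, so \<open>ennreal\<close> truncates nothing.
\<close>
definition KL :: "'a measure \<Rightarrow> 'a measure \<Rightarrow> ennreal" where
  "KL Q P =
    (if absolutely_continuous P Q \<and> integrable Q (entropy_density (exp 1) P Q)
     then ennreal (KL_divergence (exp 1) P Q)
     else \<infinity>)"

definition std_gaussian :: "'a::euclidean_space measure" where
  "std_gaussian = density lborel (\<lambda>x. ennreal (\<Prod>b\<in>Basis. std_normal_density (x \<bullet> b)))"

lemma sets_std_gaussian [simp, measurable_cong]: "sets std_gaussian = sets borel"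
  by (simp add: std_gaussian_def)

lemma prob_space_std_gaussian: "prob_space (std_gaussian :: 'a::euclidean_space measure)"
proof
  have "emeasure (std_gaussian :: 'a measure) (space std_gaussian)
      = (\<integral>\<^sup>+x. ennreal (\<Prod>b\<in>Basis. std_normal_density (x \<bullet> b)) \<partial>(lborel :: 'a measure))"
    by (simp add: std_gaussian_def emeasure_density)
  also have "\<dots> = (\<integral>\<^sup>+x. (\<Prod>b\<in>Basis. ennreal (std_normal_density (x \<bullet> b))) \<partial>(lborel :: 'a measure))"
    by (simp add: prod_ennreal)
  also have "\<dots> = (\<Prod>b\<in>(Basis::'a set). \<integral>\<^sup>+x. ennreal (std_normal_density x) \<partial>lborel)"
    by (intro nn_integral_lborel_prod) auto
  also have "(\<integral>\<^sup>+x. ennreal (std_normal_density x) \<partial>lborel) = 1"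
    using prob_space.emeasure_space_1[OF prob_space_normal_density[of 1 0]]
    by (simp add: emeasure_density)
  finally show "emeasure (std_gaussian :: 'a measure) (space std_gaussian) = 1"
    by simp
qed

text \<open>\<open>q k\<close> and \<open>p k\<close> are the conditional laws given the label \<open>y = k\<close>.\<close>
definition M_fact ::
  "nat \<Rightarrow> (nat \<Rightarrow> ('c \<times> 's::euclidean_space) measure) \<Rightarrow> (nat \<Rightarrow> 'c measure) \<Rightarrow> ennreal" where
  "M_fact K q p = (\<integral>\<^sup>+k. KL (q k) (p k \<Otimes>\<^sub>M std_gaussian) \<partial>uniform_count_measure {1..K})"

end

theory Submission
  imports Defs
begin

text \<open>
  Data processing: let \<open>f\<close> be the density of \<open>Q\<close> w.r.t. \<open>P\<close>, and \<open>g\<close> that of the push-forward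
  of \<open>Q\<close> w.r.t. the push-forward of \<open>P\<close> along \<open>T\<close>. Put \<open>h = g \<circ> T\<close>. Since \<open>ln t \<le> t - 1\<close>,
  \<open>ln h \<le> ln f + h / f - 1\<close> holds \<open>Q\<close>-almost everywhere, and
  \<open>\<integral> h / f dQ \<le> \<integral> h dP = 1\<close>. Integrating gives the inequality as soon as \<open>ln h\<close> is
  \<open>Q\<close>-integrable; its negative part is bounded by \<open>1 / h\<close>, whose \<open>Q\<close>-integral is at most 1.
\<close>

text \<open>\<open>RN_deriv\<close> is finite P-almost everywhere since \<open>Q\<close> is
  sigma-finite, so its real version, the one inside \<open>entropy_density\<close>, is still a
  density of \<open>Q\<close>.\<close>

lemma density_enn2real_RN_deriv:
  assumes "prob_space P" "prob_space Q" "absolutely_continuous P Q" "sets Q = sets P"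
  shows "density P (\<lambda>x. ennreal (enn2real (RN_deriv P Q x))) = Q"
proof -
  interpret P: prob_space P by fact
  interpret Q: prob_space Q by fact
  have "AE x in P. RN_deriv P Q x \<noteq> \<infinity>"
    using P.RN_deriv_finite[OF Q.sigma_finite_measure assms(3,4)] .
  then have "density P (\<lambda>x. ennreal (enn2real (RN_deriv P Q x))) = density P (RN_deriv P Q)"
    by (intro density_cong) (auto simp: less_top)
  then show ?thesis
    using P.density_RN_deriv[OF assms(3,4)] by simp
qed

text \<open>\<open>Q\<close> gives no mass to the zero set of its own density. Positivity is what
  licenses splitting \<open>ln\<close> of a quotient later on.\<close>

lemma AE_RN_deriv_pos:
  assumes "prob_space P" "prob_space Q" "absolutely_continuous P Q" "sets Q = sets P"
  shows "AE x in Q. 0 < enn2real (RN_deriv P Q x)"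
proof -
  have "AE x in density P (\<lambda>x. ennreal (enn2real (RN_deriv P Q x))). 0 < enn2real (RN_deriv P Q x)"
    by (subst AE_density) auto
  then show ?thesis
    unfolding density_enn2real_RN_deriv[OF assms] .
qed

text \<open>A change of measure cancels the density. It serves twice below: for \<open>P\<close>,
  \<open>Q\<close> with \<open>u = g o T\<close>, and for their push-forwards with
  \<open>u = 1\<close>.\<close>

lemma nn_integral_divide_RN_deriv_le:
  assumes "prob_space P" "prob_space Q" "absolutely_continuous P Q" "sets Q = sets P"
    and u [measurable]: "u \<in> borel_measurable P" and "\<And>x. 0 \<le> u x"
  shows "(\<integral>\<^sup>+x. ennreal (u x / enn2real (RN_deriv P Q x)) \<partial>Q) \<le> (\<integral>\<^sup>+x. ennreal (u x) \<partial>P)"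
proof -
  let ?f = "\<lambda>x. enn2real (RN_deriv P Q x)"
  have "(\<integral>\<^sup>+x. ennreal (u x / ?f x) \<partial>Q) = (\<integral>\<^sup>+x. ennreal (u x / ?f x) \<partial>density P (\<lambda>x. ennreal (?f x)))"
    by (simp add: density_enn2real_RN_deriv[OF assms(1-4)])
  also have "\<dots> = (\<integral>\<^sup>+x. ennreal (?f x) * ennreal (u x / ?f x) \<partial>P)"
    by (intro nn_integral_density) auto
  \<comment> \<open>Where the density vanishes the integrand on the left is 0, but \<open>u\<close>
    need not be; hence only an inequality.\<close>
  also have "\<dots> \<le> (\<integral>\<^sup>+x. ennreal (u x) \<partial>P)"
    by (intro nn_integral_mono) (auto simp: ennreal_mult'[symmetric] assms(6))
  finally show ?thesis .
qed

lemma absolutely_continuous_distr: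
  assumes "absolutely_continuous P Q" "sets Q = sets P" "T \<in> P \<rightarrow>\<^sub>M X"
  shows "absolutely_continuous (distr P X T) (distr Q X T)"
  unfolding absolutely_continuous_def
proof
  fix A assume "A \<in> null_sets (distr P X T)"
  then have A: "A \<in> sets X" "T -` A \<inter> space P \<in> null_sets P"
    by (auto simp: null_sets_distr_iff[OF assms(3)])
  have T: "T \<in> Q \<rightarrow>\<^sub>M X"
    using assms(3) by (simp add: measurable_cong_sets[OF assms(2) refl])
  have "T -` A \<inter> space Q \<in> null_sets Q"
    using A assms(1) sets_eq_imp_space_eq[OF assms(2)]
    by (auto simp: absolutely_continuous_def)
  then show "A \<in> null_sets (distr Q X T)"
    using A by (simp add: null_sets_distr_iff[OF T])
qed

text \<open>Integrability is claimed along with the inequality, because \<open>KL\<close> of the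
  push-forwards would otherwise take its value \<infinity>.\<close>

lemma integrable_KL_divergence_distr_le:
  fixes T :: "'a \<Rightarrow> 'b"
  assumes P: "prob_space P" and Q: "prob_space Q"
    and ac: "absolutely_continuous P Q" and sets: "sets Q = sets P"
    and T: "T \<in> P \<rightarrow>\<^sub>M X"
    and int: "integrable Q (entropy_density (exp 1) P Q)"
  shows "integrable (distr Q X T) (entropy_density (exp 1) (distr P X T) (distr Q X T))" (is ?I)
    and "KL_divergence (exp 1) (distr P X T) (distr Q X T) \<le> KL_divergence (exp 1) P Q" (is ?L)
proof -
  let ?P = "distr P X T" and ?Q = "distr Q X T"
  have TQ [measurable]: "T \<in> Q \<rightarrow>\<^sub>M X"
    using T by (simp add: measurable_cong_sets[OF sets refl])
  note T [measurable]
  interpret Q: prob_space Q by fact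
  have P': "prob_space ?P" and Q': "prob_space ?Q"
    using prob_space.prob_space_distr[OF P T] prob_space.prob_space_distr[OF Q TQ] .
  have ac': "absolutely_continuous ?P ?Q"
    by (rule absolutely_continuous_distr[OF ac sets T])
  define f where "f = (\<lambda>x. enn2real (RN_deriv P Q x))"
  define g where "g = (\<lambda>x. enn2real (RN_deriv ?P ?Q x))"
  have fP [measurable]: "f \<in> borel_measurable P" unfolding f_def by simp
  have fQ [measurable]: "f \<in> borel_measurable Q"
    using fP by (simp add: measurable_cong_sets[OF sets refl])
  have "g \<in> borel_measurable ?P" unfolding g_def by measurable
  then have g [measurable]: "g \<in> borel_measurable X" by simp
  have g_nonneg: "0 \<le> g x" for x unfolding g_def by simp
  have f_nonneg: "0 \<le> f x" for x unfolding f_def by simp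
  have ed: "entropy_density (exp 1) P Q = (\<lambda>x. ln (f x))"
    "entropy_density (exp 1) ?P ?Q = (\<lambda>x. ln (g x))"
    by (auto simp: entropy_density_def f_def g_def log_def)
  have f_pos: "AE x in Q. 0 < f x"
    unfolding f_def by (rule AE_RN_deriv_pos[OF P Q ac sets])
  have "AE x in ?Q. 0 < g x"
    unfolding g_def by (rule AE_RN_deriv_pos[OF P' Q' ac']) simp
  then have g_pos: "AE x in Q. 0 < g (T x)"
    by (subst (asm) AE_distr_iff) auto
  have int_f: "integrable Q (\<lambda>x. ln (f x))"
    using int by (simp add: ed)

  have "(\<integral>\<^sup>+x. ennreal (g (T x) / f x) \<partial>Q) \<le> (\<integral>\<^sup>+x. ennreal (g (T x)) \<partial>P)"
    unfolding f_def
    by (rule nn_integral_divide_RN_deriv_le[OF P Q ac sets]) (auto simp: g_nonneg)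
  also have "\<dots> = (\<integral>\<^sup>+x. ennreal (g x) \<partial>?P)"
    by (simp add: nn_integral_distr)
  \<comment> \<open>The measure with density \<open>g\<close> w.r.t. \<open>?P\<close> is
    \<open>?Q\<close>, so the integral is the total mass of \<open>?Q\<close>.\<close>
  also have "\<dots> = emeasure (density ?P (\<lambda>x. ennreal (g x))) (space X)"
    by (subst emeasure_density) (auto intro!: nn_integral_cong)
  also have "\<dots> = 1"
    using density_enn2real_RN_deriv[OF P' Q' ac'] prob_space.emeasure_space_1[OF Q']
    by (simp add: g_def)
  finally have gf: "(\<integral>\<^sup>+x. ennreal (g (T x) / f x) \<partial>Q) \<le> 1" .
  have int_gf: "integrable Q (\<lambda>x. g (T x) / f x)"
    using gf by (intro integrableI_nonneg) (auto simp: g_nonneg f_nonneg intro: le_less_trans)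
  have gf_le: "(\<integral>x. g (T x) / f x \<partial>Q) \<le> 1"
    using gf by (subst (asm) nn_integral_eq_integral[OF int_gf])
      (auto simp: g_nonneg f_nonneg)

  have "(\<integral>\<^sup>+x. ennreal (1 / g (T x)) \<partial>Q) = (\<integral>\<^sup>+x. ennreal (1 / g x) \<partial>?Q)"
    by (simp add: nn_integral_distr)
  also have "\<dots> \<le> (\<integral>\<^sup>+x. ennreal 1 \<partial>?P)"
    unfolding g_def by (rule nn_integral_divide_RN_deriv_le[OF P' Q' ac']) auto
  also have "\<dots> = 1"
    using prob_space.emeasure_space_1[OF P'] by simp
  finally have "(\<integral>\<^sup>+x. ennreal (1 / g (T x)) \<partial>Q) \<le> 1" .
  then have int_g1: "integrable Q (\<lambda>x. 1 / g (T x))"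
    by (intro integrableI_nonneg) (auto simp: g_nonneg intro: le_less_trans)

  \<comment> \<open>This is \<open>ln t \<le> t - 1\<close> at \<open>t = g (T x) / f x\<close>; the
    lower bound uses it at \<open>t = 1 / g (T x)\<close>.\<close>
  have upper: "AE x in Q. ln (g (T x)) \<le> ln (f x) + (g (T x) / f x - 1)"
    using f_pos g_pos
  proof eventually_elim
    case (elim x)
    then have "ln (g (T x) / f x) \<le> g (T x) / f x - 1"
      by (intro ln_le_minus_one) simp
    with elim show ?case by (simp add: ln_div)
  qed
  have lower: "AE x in Q. - ln (g (T x)) \<le> 1 / g (T x)"
    using g_pos
  proof eventually_elim
    case (elim x)
    then have "ln (1 / g (T x)) \<le> 1 / g (T x) - 1"
      by (intro ln_le_minus_one) simp
    with elim show ?case by (simp add: ln_div)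
  qed
  have int_g: "integrable Q (\<lambda>x. ln (g (T x)))"
  proof (rule Bochner_Integration.integrable_bound)
    \<comment> \<open>The first two summands dominate the positive part of
      \<open>ln (g (T x))\<close> by \<open>upper\<close>, the third its negative part by
      \<open>lower\<close>; all three are nonnegative, so the sum dominates the absolute
      value.\<close>
    show "integrable Q (\<lambda>x. \<bar>ln (f x)\<bar> + g (T x) / f x + 1 / g (T x))"
      using int_f int_gf int_g1 by auto
    show "AE x in Q. norm (ln (g (T x))) \<le> norm (\<bar>ln (f x)\<bar> + g (T x) / f x + 1 / g (T x))"
      using upper lower
    proof eventually_elim
      case (elim x)
      moreover have "0 \<le> g (T x) / f x" "0 \<le> 1 / g (T x)"
        using g_nonneg f_nonneg by auto
      ultimately show ?case
        unfolding real_norm_def by linarith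
    qed
  qed measurable
  then show ?I
    by (simp add: ed integrable_distr_eq)
  have "(\<integral>x. ln (g (T x)) \<partial>Q) \<le> (\<integral>x. ln (f x) + (g (T x) / f x - 1) \<partial>Q)"
    using upper int_g int_f int_gf by (intro integral_mono_AE) auto
  \<comment> \<open>The constant integrates to 1 as \<open>Q\<close> is a probability measure, and
    the resulting bracket is at most 0 by \<open>gf_le\<close>.\<close>
  also have "\<dots> = (\<integral>x. ln (f x) \<partial>Q) + ((\<integral>x. g (T x) / f x \<partial>Q) - 1)"
    using int_f int_gf by (simp add: Q.prob_space)
  finally show ?L
    using gf_le by (simp add: KL_divergence_def ed integral_distr)
qed

lemma KL_distr_le:
  assumes "prob_space P" "prob_space Q" "sets Q = sets P" "T \<in> P \<rightarrow>\<^sub>M X"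
  shows "KL (distr Q X T) (distr P X T) \<le> KL Q P"
proof (cases "absolutely_continuous P Q \<and> integrable Q (entropy_density (exp 1) P Q)")
  case True
  then show ?thesis
    using assms absolutely_continuous_distr[of P Q T X]
      integrable_KL_divergence_distr_le[of P Q T X]
    by (auto simp: KL_def intro: ennreal_leI)
\<comment> \<open>In the remaining case the right-hand side is \<infinity>.\<close>
next
  case False
  then show ?thesis unfolding KL_def by (simp only: if_False) simp
qed

theorem corollary2:
  fixes K :: nat
    and C :: "'c measure"
    and X :: "'x measure"
    and q :: "nat \<Rightarrow> ('c \<times> (real ^ 'ds)) measure"
    and p :: "nat \<Rightarrow> 'c measure"
    and Dec :: "'c \<times> (real ^ 'ds) \<Rightarrow> 'x"
  assumes "K \<ge> 1"
    and "\<And>k. k \<in> {1..K} \<Longrightarrow> prob_space (q k)"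
    and "\<And>k. k \<in> {1..K} \<Longrightarrow> sets (q k) = sets (C \<Otimes>\<^sub>M borel)"
    and "\<And>k. k \<in> {1..K} \<Longrightarrow> prob_space (p k)"
    and "\<And>k. k \<in> {1..K} \<Longrightarrow> sets (p k) = sets C"
    and "Dec \<in> C \<Otimes>\<^sub>M borel \<rightarrow>\<^sub>M X"
  shows "(\<integral>\<^sup>+k. KL (distr (q k) X Dec) (distr (p k \<Otimes>\<^sub>M std_gaussian) X Dec)
            \<partial>uniform_count_measure {1..K}) \<le> M_fact K q p"
  unfolding M_fact_def
\<comment> \<open>The averages are compared label by label: data processing along \<open>Dec\<close>
  from \<open>q k\<close> and the product of \<open>p k\<close> with the Gaussian.\<close>
proof (rule nn_integral_mono, rule KL_distr_le)
  fix k assume "k \<in> space (uniform_count_measure {1..K})"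
  then have k: "k \<in> {1..K}" by (simp add: space_uniform_count_measure)
  interpret p: prob_space "p k" by (rule assms(4)[OF k])
  interpret s: prob_space "std_gaussian :: (real ^ 'ds) measure" by (rule prob_space_std_gaussian)
  interpret pair_prob_space "p k" "std_gaussian :: (real ^ 'ds) measure" ..
  have sets_P: "sets (p k \<Otimes>\<^sub>M (std_gaussian :: (real ^ 'ds) measure)) = sets (C \<Otimes>\<^sub>M borel)"
    by (intro sets_pair_measure_cong assms(5)[OF k] sets_std_gaussian)
  show "prob_space (p k \<Otimes>\<^sub>M (std_gaussian :: (real ^ 'ds) measure))"
    by (rule prob_space_axioms)
  show "prob_space (q k)" by (rule assms(2)[OF k])
  show "sets (q k) = sets (p k \<Otimes>\<^sub>M std_gaussian)"
    using assms(3)[OF k] sets_P by simp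
  show "Dec \<in> p k \<Otimes>\<^sub>M std_gaussian \<rightarrow>\<^sub>M X"
    using assms(6) by (simp add: measurable_cong_sets[OF sets_P refl])
qed

end
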